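(* Let $b_n$, $n\ge0$, be the Bernoulli numbers of the second kind, defined by $\frac{x}{\ln(1+x)}=\sum_{n=0}^\infty b_n x^n$ near $x=0$. Then the sequence $\{(-1)^{n}b_{n+1}\}_{n=0}^\infty$ is completely monotonic and minimal.
   Context: The function $x/\ln(1+x)$ is extended to $x=0$ by the value $1$. A real sequence $\{\mu_n\}_{n=0}^\infty$ is completely monotonic if its elements are non-negative and $(-1)^k\Delta^k\mu_n\ge0$ for all integers $n,k\ge0$, where $\Delta^k\mu_n=\sum_{m=0}^k(-1)^m\binom{k}{m}\mu_{n+k-m}$. A completely monotonic sequence $\{a_n\}_{n=0}^\infty$ is minimal if it ceases to be completely monotonic when $a_0$ is decreased, i.e. for every $\varepsilon>0$ the sequence $a_0-\varepsilon,a_1,a_2,\dots$ is not completely monotonic. *)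

theory Defs
  imports "HOL-Analysis.Analysis"
begin

definition x_over_ln :: "real \<Rightarrow> real" where
  "x_over_ln x = (if x = 0 then 1 else x / ln (1 + x))"

text \<open>
  Bernoulli numbers of the second kind, in the normalisation without a factorial. The lemmas
  \<open>bernoulli2_sums\<close> and \<open>bernoulli2_unique\<close> below show that the description is proper.
\<close>
definition bernoulli2 :: "nat \<Rightarrow> real" where
  "bernoulli2 = (THE b. \<forall>\<^sub>F x in nhds 0. (\<lambda>n. b n * x ^ n) sums x_over_ln x)"

text \<open>In the index, \<open>n + k - m\<close> never truncates, since \<open>m \<le> k\<close>.\<close>
definition fwd_diff :: "nat \<Rightarrow> (nat \<Rightarrow> real) \<Rightarrow> nat \<Rightarrow> real" where
  "fwd_diff k \<mu> n = (\<Sum>m=0..k. (-1) ^ m * real (k choose m) * \<mu> (n + k - m))"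

definition completely_monotonic :: "(nat \<Rightarrow> real) \<Rightarrow> bool" where
  "completely_monotonic \<mu> \<longleftrightarrow>
     (\<forall>n. 0 \<le> \<mu> n) \<and> (\<forall>n k. 0 \<le> (-1) ^ k * fwd_diff k \<mu> n)"

definition minimal_completely_monotonic :: "(nat \<Rightarrow> real) \<Rightarrow> bool" where
  "minimal_completely_monotonic a \<longleftrightarrow>
     completely_monotonic a \<and> (\<forall>\<epsilon>>0. \<not> completely_monotonic (a(0 := a 0 - \<epsilon>)))"

lemma sums_near_0_iff_has_fps_expansion:
  fixes f :: "real \<Rightarrow> real"
  shows "(\<forall>\<^sub>F x in nhds 0. (\<lambda>n. b n * x ^ n) sums f x) \<longleftrightarrow> f has_fps_expansion Abs_fps b"
proof
  assume ev: "\<forall>\<^sub>F x in nhds 0. (\<lambda>n. b n * x ^ n) sums f x"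
  then obtain d where d: "d > 0" "\<And>x. dist x 0 < d \<Longrightarrow> (\<lambda>n. b n * x ^ n) sums f x"
    unfolding eventually_nhds_metric by blast
  have "(\<lambda>n. b n * (d / 2) ^ n) sums f (d / 2)" using d by auto
  then have "conv_radius b \<ge> norm (d / 2)"
    by (intro conv_radius_geI) (auto simp: sums_iff)
  moreover have "ereal (norm (d / 2)) > 0" using d(1) by simp
  ultimately have "conv_radius b > 0"
    by (rule less_le_trans[rotated])
  then have "fps_conv_radius (Abs_fps b) > 0"
    by (simp add: fps_conv_radius_def)
  moreover have "\<forall>\<^sub>F x in nhds 0. eval_fps (Abs_fps b) x = f x"
    using ev by eventually_elim (auto simp: eval_fps_def sums_iff)
  ultimately show "f has_fps_expansion Abs_fps b"
    by (simp add: has_fps_expansion_def)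
next
  assume "f has_fps_expansion Abs_fps b"
  then have r: "fps_conv_radius (Abs_fps b) > 0"
    and ev: "\<forall>\<^sub>F x in nhds 0. eval_fps (Abs_fps b) x = f x"
    by (auto simp: has_fps_expansion_def)
  have "\<forall>\<^sub>F x in nhds 0. x \<in> eball (0::real) (fps_conv_radius (Abs_fps b))"
    using r by (intro eventually_nhds_in_open) (auto simp: zero_ereal_def)
  with ev show "\<forall>\<^sub>F x in nhds 0. (\<lambda>n. b n * x ^ n) sums f x"
  proof eventually_elim
    case (elim x)
    then show ?case using sums_eval_fps[of x "Abs_fps b"] by (simp add: in_eball_iff dist_norm)
  qed
qed

lemma x_over_ln_has_fps_expansion: "x_over_ln has_fps_expansion fps_X / fps_ln 1"
proof -
  have ln: "(\<lambda>x::real. ln (1 + x)) has_fps_expansion fps_ln 1"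
  proof -
    have "\<forall>\<^sub>F x in nhds 0. x \<in> ball (0::real) 1"
      by (rule eventually_nhds_in_open) auto
    then have "\<forall>\<^sub>F x::real in nhds 0. (\<lambda>n. fps_nth (fps_ln 1) n * x ^ n) sums ln (1 + x)"
    proof eventually_elim
      case (elim x)
      have "(\<lambda>n. fps_nth (fps_ln 1) n * x ^ n) = (\<lambda>n. - ((- x) ^ n) / of_nat n)"
      proof
        fix n show "fps_nth (fps_ln 1) n * x ^ n = - ((- x) ^ n) / of_nat n"
          by (cases n) (auto simp: fps_ln_nth power_minus[of x])
      qed
      then show ?case using ln_series'[of x] elim by (simp add: dist_norm)
    qed
    then show ?thesis by (simp add: sums_near_0_iff_has_fps_expansion fps_nth_inverse)
  qed
  have nz: "fps_nth (fps_ln (1::real)) 1 \<noteq> 0" by (simp add: fps_ln_nth)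
  have sd: "subdegree (fps_ln (1::real)) = 1"
    by (rule subdegreeI) (auto simp: fps_ln_nth)
  have "(\<lambda>x::real. if x = 0 then 1 else x / ln (1 + x)) has_fps_expansion fps_X / fps_ln 1"
    by (rule has_fps_expansion_divide[OF has_fps_expansion_fps_X ln])
       (use sd nz in \<open>auto simp: fps_ln_nth\<close>)
  then show ?thesis
    by (simp add: x_over_ln_def[abs_def])
qed

lemma fps_expansion_unique_real:
  fixes f :: "real \<Rightarrow> real"
  assumes F: "f has_fps_expansion F" and G: "f has_fps_expansion G"
  shows "F = G"
proof (rule ccontr)
  assume "F \<noteq> G"
  define H where "H = F - G"
  define d where "d = subdegree H"
  have "H \<noteq> 0" using \<open>F \<noteq> G\<close> by (simp add: H_def)
  have "(\<lambda>x. f x - f x) has_fps_expansion H"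
    unfolding H_def by (rule has_fps_expansion_diff[OF F G])
  then have H: "(\<lambda>x::real. 0) has_fps_expansion H" by simp
  have "(\<lambda>x::real. if x = 0 then fps_nth H d else 0 / x ^ d) has_fps_expansion H / fps_X ^ d"
    by (rule has_fps_expansion_divide[OF H has_fps_expansion_fps_X_power])
       (auto simp: d_def subdegree_power)
  then have "isCont (\<lambda>x::real. if x = 0 then fps_nth H d else 0 / x ^ d) 0"
    by (rule has_fps_expansion_imp_continuous)
  then have "((\<lambda>x::real. if x = 0 then fps_nth H d else 0) \<longlongrightarrow> fps_nth H d) (at 0)"
    by (simp add: isCont_def cong: if_cong)
  moreover have "((\<lambda>x::real. if x = 0 then fps_nth H d else 0) \<longlongrightarrow> 0) (at 0)"
    by (rule tendsto_eventually) (auto simp: eventually_at_filter)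
  ultimately have "fps_nth H d = 0"
    using LIM_unique by blast
  then show False using \<open>H \<noteq> 0\<close> by (simp add: d_def)
qed

lemma ex1_bernoulli2:
  "\<exists>!b. \<forall>\<^sub>F x in nhds 0. (\<lambda>n. b n * x ^ n) sums x_over_ln x"
  unfolding sums_near_0_iff_has_fps_expansion
proof (rule ex1I)
  show "x_over_ln has_fps_expansion Abs_fps (fps_nth (fps_X / fps_ln 1))"
    using x_over_ln_has_fps_expansion by (simp add: fps_nth_inverse)
next
  fix b assume "x_over_ln has_fps_expansion Abs_fps b"
  then have "Abs_fps b = fps_X / fps_ln 1"
    using x_over_ln_has_fps_expansion fps_expansion_unique_real by blast
  then show "b = fps_nth (fps_X / fps_ln 1)" by (metis fps_nth_Abs_fps ext)
qed

lemma bernoulli2_sums: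
  "\<forall>\<^sub>F x in nhds 0. (\<lambda>n. bernoulli2 n * x ^ n) sums x_over_ln x"
  unfolding bernoulli2_def by (rule theI'[OF ex1_bernoulli2])

lemma bernoulli2_unique:
  assumes "\<forall>\<^sub>F x in nhds 0. (\<lambda>n. b n * x ^ n) sums x_over_ln x"
  shows "b = bernoulli2"
  using ex1_bernoulli2 bernoulli2_sums assms by blast

end

theory Submission
  imports Defs
begin

text \<open>
  Integrating the binomial series of \<open>(1 + x)\<^sup>s\<close> over \<open>0 \<le> s \<le> 1\<close> shows that \<open>b\<^sub>n\<close> is the
  integral of \<open>s gchoose n\<close>. By Pascal's rule, the alternating differences of the sequence
  \<open>(-1)\<^sup>n b\<^bsub>n+1\<^esub>\<close> are the integrals of \<open>(-1)\<^sup>n (s + k gchoose (n + k + 1))\<close>, and these integrands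
  are non-negative on \<open>[0,1]\<close>. At \<open>n = 0\<close> the integrand is at most \<open>exp (- (1 - s) H\<^bsub>k+1\<^esub>)\<close> with the
  harmonic number \<open>H\<^bsub>k+1\<^esub>\<close>, so that the differences there tend to \<open>0\<close>; decreasing the first term
  by \<open>\<epsilon>\<close> decreases each of them by \<open>\<epsilon>\<close> and thus makes some of them negative.
\<close>

lemma continuous_on_gbinomial:
  fixes f :: "'a::topological_space \<Rightarrow> real"
  assumes "continuous_on A f"
  shows "continuous_on A (\<lambda>x. f x gchoose n)"
  unfolding gbinomial_prod_rev using assms by (intro continuous_intros) auto

lemma integrable_gbinomial: "(\<lambda>s::real. (s + c) gchoose n) integrable_on {0..1}"
  by (intro integrable_continuous_real continuous_on_gbinomial continuous_intros)

text \<open>The factor \<open>s - i\<close> of the falling factorial is at most \<open>i + 1\<close>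
  in absolute value, and these bounds multiply to \<open>fact n\<close>. Being uniform in
  \<open>s\<close>, the bound supplies the majorant for the Weierstrass M-test.\<close>

lemma abs_gbinomial_le_1:
  fixes s :: real
  assumes "s \<in> {0..1}"
  shows "\<bar>s gchoose n\<bar> \<le> 1"
proof -
  have "\<bar>s - real i\<bar> \<le> real (Suc i)" for i
    using assms by auto
  then have "(\<Prod>i<n. \<bar>s - real i\<bar>) \<le> (\<Prod>i<n. real (Suc i))"
    by (intro prod_mono) auto
  also have "\<dots> = fact n"
    by (simp add: fact_prod_Suc atLeast0LessThan)
  finally show ?thesis
    by (simp add: gbinomial_prod_rev abs_prod atLeast0LessThan)
qed

text \<open>An antiderivative in the exponent is \<open>(1 + x) powr s / ln (1 + x)\<close>. At
  \<open>x = 0\<close> the integrand is constantly 1, which matches the extended value.\<close>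

lemma has_integral_powr_exponent:
  assumes "x > -1"
  shows "((\<lambda>s. (1 + x) powr s) has_integral x_over_ln x) {0..1}"
proof (cases "x = 0")
  case True
  then show ?thesis
    using has_integral_const_real[of "1::real" 0 1] by (simp add: x_over_ln_def)
next
  case False
  with assms have "ln (1 + x) \<noteq> 0"
    by simp
  then have "((\<lambda>s. (1 + x) powr s / ln (1 + x)) has_vector_derivative (1 + x) powr s)
      (at s within {0..1})" for s
    unfolding has_real_derivative_iff_has_vector_derivative[symmetric]
    using assms by (auto intro!: derivative_eq_intros simp: powr_def)
  then have "((\<lambda>s. (1 + x) powr s) has_integral
      (1 + x) powr 1 / ln (1 + x) - (1 + x) powr 0 / ln (1 + x)) {0..1}"
    by (intro fundamental_theorem_of_calculus) auto
  then show ?thesis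
    using assms False by (simp add: x_over_ln_def diff_divide_distrib[symmetric])
qed

lemma integral_gbinomial_sums:
  fixes x :: real
  assumes x: "\<bar>x\<bar> < 1"
  shows "(\<lambda>n. integral {0..1} (\<lambda>s::real. s gchoose n) * x ^ n) sums x_over_ln x"
proof -
  let ?S = "\<lambda>N s. \<Sum>n<N. (s gchoose n) * x ^ n"
  have lim: "uniform_limit {0..1} ?S (\<lambda>s. \<Sum>n. (s gchoose n) * x ^ n) sequentially"
  proof (rule Weierstrass_m_test)
    show "norm ((s gchoose n) * x ^ n) \<le> \<bar>x\<bar> ^ n" if "s \<in> {0..1}" for n and s :: real
      using abs_gbinomial_le_1[OF that, of n]
      by (simp add: abs_mult power_abs mult_left_le_one_le)
    show "summable (\<lambda>n. \<bar>x\<bar> ^ n)"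
      using x by (simp add: summable_geometric)
  qed
  have sum_eq: "(\<Sum>n. (s gchoose n) * x ^ n) = (1 + x) powr s" for s
    using gen_binomial_real[OF x, of s] by (simp add: sums_iff)
  have S: "(?S N has_integral (\<Sum>n<N. integral {0..1} (\<lambda>s. s gchoose n) * x ^ n)) {0..1}" for N
    using integrable_gbinomial[of 0]
    by (intro has_integral_sum has_integral_mult_left integrable_integral) auto
  \<comment> \<open>Uniform convergence in \<open>s\<close> permits integration term by term; the
    integrals so obtained are then identified by uniqueness.\<close>
  obtain I J
    where I: "\<And>N. (?S N has_integral I N) {0..1}"
      and J: "((\<lambda>s. \<Sum>n. (s gchoose n) * x ^ n) has_integral J) {0..1}"
      and "I \<longlonglongrightarrow> J"
    by (rule uniform_limit_integral[OF lim])
       (auto intro!: continuous_intros continuous_on_gbinomial)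
  moreover have "I = (\<lambda>N. \<Sum>n<N. integral {0..1} (\<lambda>s::real. s gchoose n) * x ^ n)"
    using has_integral_unique[OF I S] by blast
  moreover have "J = x_over_ln x"
    using has_integral_unique[OF J[unfolded sum_eq] has_integral_powr_exponent] x by simp
  ultimately show ?thesis
    by (simp add: sums_def)
qed

lemma bernoulli2_eq_integral: "bernoulli2 n = integral {0..1} (\<lambda>s::real. s gchoose n)"
proof -
  have "\<forall>\<^sub>F x in nhds 0. x \<in> ball (0::real) 1"
    by (rule eventually_nhds_in_open) auto
  then have "\<forall>\<^sub>F x in nhds 0.
      (\<lambda>n. integral {0..1} (\<lambda>s::real. s gchoose n) * x ^ n) sums x_over_ln x"
    by eventually_elim (simp add: integral_gbinomial_sums dist_norm)
  then show ?thesis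
    by (rule bernoulli2_unique[THEN fun_cong, symmetric])
qed

lemma fwd_diff_0: "fwd_diff 0 \<mu> n = \<mu> n"
  by (simp add: fwd_diff_def)

lemma fwd_diff_Suc: "fwd_diff (Suc k) \<mu> n = fwd_diff k \<mu> (Suc n) - fwd_diff k \<mu> n"
proof -
  let ?f = "\<lambda>m. (-1) ^ m * real (k choose m) * \<mu> (Suc n + k - m)"
  let ?g = "\<lambda>m. (-1) ^ m * real (k choose m) * \<mu> (n + k - m)"
  have "fwd_diff (Suc k) \<mu> n =
      \<mu> (Suc (n + k)) + (\<Sum>m\<le>k. (-1) ^ Suc m * real (Suc k choose Suc m) * \<mu> (n + k - m))"
    unfolding fwd_diff_def atLeast0AtMost by (subst sum.atMost_Suc_shift) simp
  also have "\<dots> = \<mu> (Suc (n + k)) + ((\<Sum>m\<le>k. ?f (Suc m)) - (\<Sum>m\<le>k. ?g m))"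
    by (simp add: sum_subtractf[symmetric] distrib_left left_diff_distrib
        minus_diff_commute)
  also have "\<dots> = (\<Sum>m\<le>Suc k. ?f m) - (\<Sum>m\<le>k. ?g m)"
    by (subst sum.atMost_Suc_shift) simp
  \<comment> \<open>The extra summand \<open>?f (Suc k)\<close> vanishes because
    \<open>k choose Suc k\<close> is 0.\<close>
  also have "\<dots> = fwd_diff k \<mu> (Suc n) - fwd_diff k \<mu> n"
    by (simp add: fwd_diff_def atLeast0AtMost)
  finally show ?thesis .
qed

text \<open>Only the summand \<open>m = k\<close> involves \<open>\<mu> 0\<close>, and its
  coefficient is \<open>(-1) ^ k\<close>.\<close>

lemma fwd_diff_fun_upd_0: "fwd_diff k (\<mu>(0 := \<mu> 0 - \<epsilon>)) 0 = fwd_diff k \<mu> 0 - (-1) ^ k * \<epsilon>"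
proof -
  have "(\<Sum>m<k. (-1) ^ m * real (k choose m) * (\<mu>(0 := \<mu> 0 - \<epsilon>)) (k - m)) =
      (\<Sum>m<k. (-1) ^ m * real (k choose m) * \<mu> (k - m))"
    by (rule sum.cong) auto
  then show ?thesis
    by (simp add: fwd_diff_def atLeast0AtMost lessThan_Suc_atMost[symmetric] algebra_simps)
qed

lemma fwd_diff_bernoulli2:
  "(-1) ^ k * fwd_diff k (\<lambda>n. (-1) ^ n * bernoulli2 (n + 1)) n =
     (-1) ^ n * integral {0..1} (\<lambda>s. s + real k gchoose (n + k + 1))"
proof (induction k arbitrary: n)
  case 0
  show ?case
    by (simp add: fwd_diff_0 bernoulli2_eq_integral)
next
  case (Suc k)
  let ?I = "\<lambda>j. integral {0..1} (\<lambda>s. s + real k gchoose j)"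
  have "?I (n + k + 1) + ?I (n + k + 2) =
      integral {0..1} (\<lambda>s. (s + real k gchoose (n + k + 1)) + (s + real k gchoose (n + k + 2)))"
    by (rule integral_add[symmetric]) (rule integrable_gbinomial)+
  also have "\<dots> = integral {0..1} (\<lambda>s. s + real (Suc k) gchoose (n + Suc k + 1))"
    using gbinomial_Suc_Suc[of "_ + real k" "n + k + 1"] by (simp add: algebra_simps)
  finally have pascal: "?I (n + k + 1) + ?I (n + k + 2) =
      integral {0..1} (\<lambda>s. s + real (Suc k) gchoose (n + Suc k + 1))" .
  have "(-1) ^ Suc k * fwd_diff (Suc k) (\<lambda>n. (-1) ^ n * bernoulli2 (n + 1)) n =
      (-1) ^ n * ?I (n + k + 1) - (-1) ^ Suc n * ?I (Suc n + k + 1)"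
    unfolding Suc.IH[symmetric] fwd_diff_Suc by (simp add: right_diff_distrib)
  \<comment> \<open>The minus sign of the difference cancels the sign change from \<open>n\<close>
    to \<open>Suc n\<close>, so the integrals add up as in Pascal's rule.\<close>
  also have "\<dots> = (-1) ^ n * (?I (n + k + 1) + ?I (n + k + 2))"
    by (simp add: distrib_left)
  finally show ?case
    unfolding pascal .
qed

text \<open>For \<open>n = 0\<close> every factor of the product is non-negative. Each further step
  in \<open>n\<close> contributes the factor \<open>(s - (n + 1)) / (n + k + 2)\<close>, which is
  non-positive on \<open>[0,1]\<close>.\<close>

lemma gbinomial_shift_sign:
  fixes s :: real
  assumes "s \<in> {0..1}"
  shows "0 \<le> (-1) ^ n * (s + real k gchoose (n + k + 1))"
proof (induction n)
  case 0
  have "0 \<le> (\<Prod>i = 0..k. s + real k - real i)"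
    using assms by (intro prod_nonneg) auto
  then show ?case
    by (simp add: gbinomial_prod_rev atLeastLessThanSuc_atLeastAtMost)
next
  case (Suc n)
  \<comment> \<open>With \<open>a = s + k\<close> and \<open>m = n + k + 1\<close>, both absorption
    identities have the right-hand side \<open>a * (a - 1 gchoose m)\<close>; equating their
    left-hand sides gives the ratio of consecutive coefficients.\<close>
  have "(-1) ^ Suc n * (s + real k gchoose (Suc n + k + 1)) =
      (-1) ^ n * (s + real k gchoose (n + k + 1)) * ((real (n + 1) - s) / real (n + k + 2))"
    using gbinomial_absorb_comp[of "s + real k" "n + k + 1"]
      gbinomial_absorption[of "n + k + 1" "s + real k"]
    by (simp add: field_simps)
  moreover have "0 \<le> (real (n + 1) - s) / real (n + k + 2)"
    using assms by simp
  ultimately show ?case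
    using Suc.IH by (metis mult_nonneg_nonneg)
qed

text \<open>The coefficient is the product of the factors \<open>1 + (s - 1) / j\<close> for
  \<open>j = 1..k+1\<close>; applying \<open>1 + t \<le> exp t\<close> to each makes the exponents
  sum to a multiple of the harmonic number.\<close>

lemma gbinomial_shift_le_exp:
  fixes s :: real
  assumes "s \<in> {0..1}"
  shows "s + real k gchoose (k + 1) \<le> exp ((s - 1) * harm (k + 1))"
proof -
  have "s + real k gchoose (k + 1) = pochhammer s (k + 1) / fact (k + 1)"
    using gbinomial_pochhammer'[of "s + real k" "k + 1"] by simp
  also have "pochhammer s (k + 1) = (\<Prod>j=1..k+1. s + real j - 1)"
    by (induction k) (simp_all add: pochhammer_Suc add_ac)
  also have "\<dots> / fact (k + 1) = (\<Prod>j=1..k+1. (s + real j - 1) / real j)"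
    by (simp add: fact_prod prod_dividef distrib_left)
  also have "\<dots> \<le> (\<Prod>j=1..k+1. exp ((s - 1) * inverse (real j)))"
  proof (intro prod_mono conjI)
    fix j assume j: "j \<in> {1..k+1}"
    then show "0 \<le> (s + real j - 1) / real j"
      using assms by auto
    have "(s + real j - 1) / real j = 1 + (s - 1) * inverse (real j)"
      using j by (simp add: field_simps)
    also have "\<dots> \<le> exp ((s - 1) * inverse (real j))"
      by (rule exp_ge_add_one_self)
    finally show "(s + real j - 1) / real j \<le> exp ((s - 1) * inverse (real j))" .
  qed
  also have "\<dots> = exp ((s - 1) * harm (k + 1))"
    by (simp only: harm_def sum_distrib_left exp_sum finite_atLeastAtMost)
  finally show ?thesis .
qed

lemma integral_gbinomial_shift_le: "integral {0..1} (\<lambda>s. s + real k gchoose (k + 1))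
    \<le> 1 / harm (k + 1)"
proof -
  define H :: real where "H = harm (k + 1)"
  have H: "H > 0"
    unfolding H_def by (rule harm_pos) simp
  have "((\<lambda>s. exp ((s - 1) * H) / H) has_vector_derivative exp ((s - 1) * H))
      (at s within {0..1})" for s
    unfolding has_real_derivative_iff_has_vector_derivative[symmetric]
    using H by (auto intro!: derivative_eq_intros)
  then have int: "((\<lambda>s. exp ((s - 1) * H)) has_integral
      exp ((1 - 1) * H) / H - exp ((0 - 1) * H) / H) {0..1}"
    by (intro fundamental_theorem_of_calculus) auto
  have "integral {0..1} (\<lambda>s. s + real k gchoose (k + 1)) \<le>
      exp ((1 - 1) * H) / H - exp ((0 - 1) * H) / H"
    by (rule has_integral_le[OF integrable_integral int])
       (rule integrable_gbinomial, unfold H_def, rule gbinomial_shift_le_exp)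
  \<comment> \<open>The value is \<open>(1 - exp (- H)) / H\<close>, and \<open>exp (- H)\<close> is
    positive.\<close>
  also have "\<dots> \<le> 1 / harm (k + 1)"
    unfolding H_def[symmetric] using H by simp
  finally show ?thesis .
qed

lemma completely_monotonic_bernoulli2: "completely_monotonic (\<lambda>n. (-1) ^ n * bernoulli2 (n + 1))"
proof -
  let ?a = "\<lambda>n. (-1) ^ n * bernoulli2 (n + 1)"
  have nonneg: "0 \<le> (-1) ^ k * fwd_diff k ?a n" for k n
  proof -
    have "0 \<le> integral {0..1} (\<lambda>s. (-1) ^ n * (s + real k gchoose (n + k + 1)))"
      by (intro integral_nonneg integrable_on_mult_right integrable_gbinomial gbinomial_shift_sign)
    then show ?thesis
      unfolding fwd_diff_bernoulli2 by simp
  qed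
  moreover have "0 \<le> ?a n" for n
    using nonneg[of 0 n] by (simp add: fwd_diff_0)
  ultimately show ?thesis
    by (simp add: completely_monotonic_def)
qed

theorem theorem5p1:
  shows "completely_monotonic (\<lambda>n. (-1) ^ n * bernoulli2 (n + 1)) \<and>
         minimal_completely_monotonic (\<lambda>n. (-1) ^ n * bernoulli2 (n + 1))"
proof -
  let ?a = "\<lambda>n. (-1) ^ n * bernoulli2 (n + 1)"
  have "\<not> completely_monotonic (?a(0 := ?a 0 - \<epsilon>))" if \<epsilon>: "\<epsilon> > 0" for \<epsilon>
  proof
    assume "completely_monotonic (?a(0 := ?a 0 - \<epsilon>))"
    then have "0 \<le> (-1) ^ k * fwd_diff k (?a(0 := ?a 0 - \<epsilon>)) 0" for k
      unfolding completely_monotonic_def by blast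
    then have "0 \<le> (-1) ^ k * fwd_diff k ?a 0 - (-1) ^ k * ((-1) ^ k * \<epsilon>)" for k
      unfolding fwd_diff_fun_upd_0[of _ ?a] right_diff_distrib .
    \<comment> \<open>The two signs \<open>(-1) ^ k\<close> cancel, so the loss is exactly
      \<open>\<epsilon>\<close> for every \<open>k\<close>.\<close>
    then have "0 \<le> (-1) ^ k * fwd_diff k ?a 0 - \<epsilon>" for k
      by (simp only: left_minus_one_mult_self)
    then have le: "\<epsilon> \<le> 1 / harm (k + 1)" for k
      using integral_gbinomial_shift_le[of k] order_trans
      unfolding fwd_diff_bernoulli2 by fastforce
    \<comment> \<open>Divergence of the harmonic series contradicts a bound on
      \<open>\<epsilon>\<close> that holds for all \<open>k\<close>.\<close>
    have "\<forall>\<^sub>F k in sequentially. 1 / \<epsilon> < (harm k :: real)"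
      using harm_at_top by (simp add: filterlim_at_top_dense)
    then obtain k where "1 / \<epsilon> < (harm (k + 1) :: real)"
      by (metis Suc_eq_plus1 eventually_sequentially le_SucI order_refl)
    moreover have "(harm (k + 1) :: real) > 0"
      by (rule harm_pos) simp
    ultimately show False
      using le[of k] \<epsilon> by (simp add: field_simps)
  qed
  with completely_monotonic_bernoulli2 show ?thesis
    by (simp add: minimal_completely_monotonic_def)
qed

end
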